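(* Let $n,k,l,r$ be integers with $k,r\geq 2$ and $n\geq l\geq t+1$, where $t=t(k,r)$. If $H$ is a $(k,l)$-edge-maximal $r$-uniform hypergraph on $n$ vertices, then \[ |E(H)|\geq \begin{cases} \binom{l-1}{r}+(n-l+1)k, & l\leq n<2t,\\ (n-1)k-\left((t-1)k-\binom{t}{r}\right)\left\lfloor\frac{n}{t}\right\rfloor, & l\leq 2t\leq n,\\ (n-2a+1)k+2\binom{a}{r}-\left((t-1)k-\binom{t}{r}\right)\left\lfloor\frac{n-2a}{t}\right\rfloor, & n\geq l=2a\geq 2t+1,\\ (n-2b)k+\binom{b}{r}+\binom{b+1}{r}-\left((t-1)k-\binom{t}{r}\right)\left\lfloor\frac{n-2b-1}{t}\right\rfloor, & n\geq l=2b+1\geq 2t+1. \end{cases} \]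
   Context: A hypergraph $H=(V,E)$ has a finite vertex set $V$ and a set $E$ of nonempty subsets of $V$ (edges); it is $r$-uniform if every edge has exactly $r$ elements. A subhypergraph $H'=(V',E')$ of $H$ has $V'\subseteq V$, $E'\subseteq E$ (with each edge of $E'$ contained in $V'$). For $X\subseteq V$, $d_H(X)$ is the number of edges meeting both $X$ and $V\setminus X$; $\kappa'(H)=\min\{d_H(X):\emptyset\neq X\subsetneq V\}$. For an $r$-subset $e\notin E$ of $V$, $H+e=(V,E\cup\{e\})$. An $r$-uniform hypergraph $H$ is $(k,l)$-edge-maximal if every subhypergraph $H'$ with $|V(H')|\geq l$ has $\kappa'(H')\leq k$, but for every $r$-subset $e$ of $V(H)$ not in $E(H)$, $H+e$ has a subhypergraph $H''$ with $|V(H'')|\geq l$ and $\kappa'(H'')\geq k+1$. Binomial coefficients are $0$ when the lower index exceeds the upper. For $k,r\geq2$, $t=t(k,r)$ is the integer with $\binom{t-1}{r-1}\leq k<\binom{t}{r-1}$. *)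

theory Defs
  imports Complex_Main
begin

datatype 'a hypergraph = Hypergraph (verts: "'a set") (edges: "'a set set")

definition wf_hypergraph :: "'a hypergraph \<Rightarrow> bool" where
  "wf_hypergraph H \<longleftrightarrow> finite (verts H) \<and> (\<forall>e\<in>edges H. e \<noteq> {} \<and> e \<subseteq> verts H)"

definition uniform :: "nat \<Rightarrow> 'a hypergraph \<Rightarrow> bool" where
  "uniform r H \<longleftrightarrow> (\<forall>e\<in>edges H. card e = r)"

definition subhypergraph :: "'a hypergraph \<Rightarrow> 'a hypergraph \<Rightarrow> bool" where
  "subhypergraph H' H \<longleftrightarrow>
     verts H' \<subseteq> verts H \<and> edges H' \<subseteq> edges H \<and> (\<forall>e\<in>edges H'. e \<subseteq> verts H')"

definition cut_degree :: "'a hypergraph \<Rightarrow> 'a set \<Rightarrow> nat" where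
  "cut_degree H X = card {e \<in> edges H. e \<inter> X \<noteq> {} \<and> e \<inter> (verts H - X) \<noteq> {}}"

text \<open>For hypergraphs with fewer than two vertices the minimum ranges over the empty set and the
  value is unspecified.\<close>

definition edge_connectivity :: "'a hypergraph \<Rightarrow> nat" where
  "edge_connectivity H = Min {cut_degree H X | X. X \<noteq> {} \<and> X \<subset> verts H}"

definition add_edge :: "'a hypergraph \<Rightarrow> 'a set \<Rightarrow> 'a hypergraph" where
  "add_edge H e = Hypergraph (verts H) (insert e (edges H))"

definition edge_maximal :: "nat \<Rightarrow> nat \<Rightarrow> nat \<Rightarrow> 'a hypergraph \<Rightarrow> bool" where
  "edge_maximal r k l H \<longleftrightarrow>
     wf_hypergraph H \<and> uniform r H \<and>
     (\<forall>H'. subhypergraph H' H \<and> card (verts H') \<ge> l \<longrightarrow> edge_connectivity H' \<le> k) \<and>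
     (\<forall>e. e \<subseteq> verts H \<and> card e = r \<and> e \<notin> edges H \<longrightarrow>
        (\<exists>H''. subhypergraph H'' (add_edge H e) \<and> card (verts H'') \<ge> l \<and>
               edge_connectivity H'' \<ge> k + 1))"

text \<open>Truncated subtraction does no harm in \<open>t - 1\<close>: the second inequality excludes
  \<open>t = 0\<close> when \<open>r \<ge> 2\<close>.\<close>

definition t_param :: "nat \<Rightarrow> nat \<Rightarrow> nat" where
  "t_param k r = (THE t. (t - 1) choose (r - 1) \<le> k \<and> k < t choose (r - 1))"

lemma t_param_ex1:
  assumes "r \<ge> 2"
  shows "\<exists>!t. (t - 1) choose (r - 1) \<le> k \<and> k < t choose (r - 1)"
proof -
  let ?P = "\<lambda>t. k < t choose (r - 1)"
  obtain s where s: "r - 1 = Suc s"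
    using assms by (cases "r - 1") auto
  have "k < (Suc s + k) choose Suc s"
  proof (induction k)
    case (Suc k)
    have "(Suc s + Suc k) choose Suc s = ((Suc s + k) choose s) + ((Suc s + k) choose Suc s)"
      by simp
    moreover have "(Suc s + k) choose s > 0"
      by (simp add: zero_less_binomial)
    ultimately show ?case using Suc by linarith
  qed simp
  then have "?P (r - 1 + k)" by (simp only: s)
  moreover have "\<not> ?P 0"
    by (simp only: s) simp
  ultimately obtain m where m: "\<forall>i\<le>m. \<not> ?P i" "?P (Suc m)"
    using ex_least_nat_less[of ?P] by blast
  from m(1) have "m choose (r - 1) \<le> k"
    by (meson le_refl not_less)
  with m(2) have ex: "\<exists>t. (t - 1) choose (r - 1) \<le> k \<and> ?P t"
    by (intro exI[of _ "Suc m"]) simp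
  have "t' \<le> t" if "(t' - 1) choose (r - 1) \<le> k" "?P t" for t t'
  proof (rule ccontr)
    assume "\<not> t' \<le> t"
    then have "t \<le> t' - 1" by linarith
    then have "t choose (r - 1) \<le> (t' - 1) choose (r - 1)"
      by (rule lift_Suc_mono_le[where f = "\<lambda>n. n choose (r - 1)", rotated])
         (simp_all only: s binomial_Suc_Suc le_add2)
    with that show False by linarith
  qed
  note upper = this
  from ex obtain t where t: "(t - 1) choose (r - 1) \<le> k" "?P t" by blast
  show ?thesis
  proof (rule ex1I[of _ t])
    show "(t - 1) choose (r - 1) \<le> k \<and> ?P t" using t by (rule conjI)
    show "t' = t" if "(t' - 1) choose (r - 1) \<le> k \<and> ?P t'" for t'
      using upper[of t' t] upper[of t t'] t that by (intro le_antisym) blast+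
  qed
qed

lemma t_param:
  assumes "r \<ge> 2"
  shows "(t_param k r - 1) choose (r - 1) \<le> k" and "k < t_param k r choose (r - 1)"
  using theI'[OF t_param_ex1[OF assms, of k]] unfolding t_param_def by blast+

end

(* Adding a missing edge across a cut X with d(X) <= k raises the connectivity of some large
   subhypergraph above k.  Hence d(X) = k, and each side of the cut is again (k,l)-edge-maximal if it
   has at least l vertices, and complete otherwise.  A degree count shows that if a cut with at most
   k edges has a side of fewer than t vertices, then some single vertex has degree at most k; so H
   always splits along k edges either into a vertex and the rest, or into two parts with at least t
   vertices each.

   The excess |E| - (|V| - 1) k is additive over such a split.  For the complete hypergraph on m
   vertices it is f(m) = C(m,r) - (m - 1) k, a convex function of m with minimum at t and f(1) = 0,
   so strong induction on |V| yields, with floors behaving superadditively: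
   below 2t vertices only single vertices can be split off, giving f(l-1);
   in general f(t) floor(n/t); and for l > 2t the bound
   f(floor(l/2)) + f(ceiling(l/2)) + f(t) floor((n-l)/t), by convexity. *)

theory Submission
  imports Defs
begin

section \<open>Inequalities for binomial coefficients\<close>

text \<open>Discrete convexity: moving one unit from the larger part to the smaller part
  \<open>j\<close> adds C(j, r-1) and removes C(s-j-1, r-1), and j <= s-j-1 as long as
  \<open>j < c\<close>.\<close>

lemma choose_balanced_le:
  fixes x c s r :: nat
  assumes "x \<le> c" "2 * c \<le> s"
  shows "(c choose r) + ((s - c) choose r) \<le> (x choose r) + ((s - x) choose r)"
  using assms
proof (induction rule: dec_induct)
  case (step j)
  have s: "s - j = Suc (s - Suc j)" using step.prems by simp
  have "(Suc j choose r) + ((s - Suc j) choose r) \<le> (j choose r) + ((s - j) choose r)"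
  proof (cases r)
    case (Suc q)
    have "j choose q \<le> (s - Suc j) choose q"
      using step.prems by (intro binomial_right_mono) simp
    then show ?thesis unfolding Suc s by simp
  qed simp
  with step show ?case by simp
qed simp

text \<open>Two sets of sizes x+1 and y+1 that share one point have a union of size x+y+1 and, as r
  >= 2, no common r-subset.\<close>

lemma choose_superadditive:
  fixes x y r :: nat
  assumes "r \<ge> 2"
  shows "(Suc x choose r) + (Suc y choose r) \<le> Suc (x + y) choose r"
proof (induction x)
  case (Suc x)
  obtain q where q: "r = Suc q" using assms by (cases r) auto
  have "Suc x choose q \<le> Suc (x + y) choose q" by (intro binomial_right_mono) simp
  moreover have "Suc (Suc x) choose r = (Suc x choose q) + (Suc x choose r)"
    "Suc (Suc x + y) choose r = (Suc (x + y) choose q) + (Suc (x + y) choose r)"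
    unfolding q by simp_all
  ultimately show ?case using Suc.IH by linarith
qed (use assms in simp)

text \<open>For t < r the coefficient C(t, r-1) is at most 1, but it must exceed k >= 1.\<close>

lemma t_param_ge:
  assumes "k \<ge> 1" "r \<ge> 2"
  shows "t_param k r \<ge> r"
proof (rule ccontr)
  assume "\<not> t_param k r \<ge> r"
  then have "t_param k r choose (r - 1) \<le> (r - 1) choose (r - 1)"
    by (intro binomial_right_mono) simp
  then show False using t_param(2)[OF assms(2), of k] assms(1) by simp
qed

section \<open>Cuts, edge connectivity and induced sides\<close>

lemma edge_connectivity_le_cut_degree:
  assumes "finite (verts H)" "X \<noteq> {}" "X \<subset> verts H"
  shows "edge_connectivity H \<le> cut_degree H X"
proof -
  have "{cut_degree H X | X. X \<noteq> {} \<and> X \<subset> verts H} \<subseteq> cut_degree H ` Pow (verts H)"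
    by blast
  then have "finite {cut_degree H X | X. X \<noteq> {} \<and> X \<subset> verts H}"
    by (rule finite_subset) (simp add: assms(1))
  then show ?thesis
    unfolding edge_connectivity_def by (rule Min_le) (use assms in blast)
qed

text \<open>Two vertices guarantee a nonempty proper subset, so \<open>Min\<close> ranges over a
  nonempty set and is attained.\<close>

lemma edge_connectivity_attained:
  assumes "card (verts H) \<ge> 2"
  obtains X where "X \<noteq> {}" "X \<subset> verts H" "cut_degree H X = edge_connectivity H"
proof -
  let ?S = "{cut_degree H X | X. X \<noteq> {} \<and> X \<subset> verts H}"
  have fin: "finite (verts H)" using assms by (metis card.infinite not_numeral_le_zero)
  have "?S \<subseteq> cut_degree H ` Pow (verts H)" by blast
  then have "finite ?S" by (rule finite_subset) (simp add: fin)
  moreover obtain v where "v \<in> verts H" using assms by fastforce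
  then have "{v} \<subset> verts H" using assms by (metis card_1_singleton_iff
    empty_subsetI insert_subset not_less_eq_eq numeral_2_eq_2 psubsetI order_refl)
  then have "?S \<noteq> {}" by blast
  ultimately have "Min ?S \<in> ?S" by (rule Min_in)
  then have "\<exists>X. Min ?S = cut_degree H X \<and> X \<noteq> {} \<and> X \<subset> verts H" by (rule CollectD)
  then show thesis using that unfolding edge_connectivity_def by metis
qed

lemma finite_edges: "wf_hypergraph H \<Longrightarrow> finite (edges H)"
  unfolding wf_hypergraph_def by (rule finite_subset[of _ "Pow (verts H)"]) auto

definition induced :: "'a hypergraph \<Rightarrow> 'a set \<Rightarrow> 'a hypergraph" where
  "induced H X = Hypergraph X {e \<in> edges H. e \<subseteq> X}"

lemma induced_simps [simp]:
  "verts (induced H X) = X" "edges (induced H X) = {e \<in> edges H. e \<subseteq> X}"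
  by (simp_all add: induced_def)

definition complete_uniform :: "nat \<Rightarrow> 'a hypergraph \<Rightarrow> bool" where
  "complete_uniform r H \<longleftrightarrow> finite (verts H) \<and> edges H = {e. e \<subseteq> verts H \<and> card e = r}"

text \<open>The invariant of the inductions: it passes to both sides of any cut with at most
  \<open>k\<close> edges. Below \<open>l\<close> vertices no added edge can create a large enough
  witness, so no \<open>r\<close>-subset may be missing there.\<close>

definition maximal_or_small_complete :: "nat \<Rightarrow> nat \<Rightarrow> nat \<Rightarrow> 'a hypergraph \<Rightarrow> bool" where
  "maximal_or_small_complete r k l H \<longleftrightarrow>
     (if card (verts H) < l then complete_uniform r H else edge_maximal r k l H)"

lemma cut_degree_compl:
  assumes "X \<subseteq> verts H"
  shows "cut_degree H (verts H - X) = cut_degree H X"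
  using assms unfolding cut_degree_def by (simp add: double_diff conj_commute)

text \<open>An edge crosses the cut or lies in exactly one side; an empty edge would be counted on
  both sides, which \<open>wf_hypergraph\<close> excludes.\<close>

lemma card_edges_cut:
  assumes "wf_hypergraph H" "X \<subseteq> verts H"
  shows "card (edges H) =
    cut_degree H X + card (edges (induced H X)) + card (edges (induced H (verts H - X)))"
proof -
  let ?A = "{e \<in> edges H. e \<inter> X \<noteq> {} \<and> e \<inter> (verts H - X) \<noteq> {}}"
  let ?B = "{e \<in> edges H. e \<subseteq> X}" and ?C = "{e \<in> edges H. e \<subseteq> verts H - X}"
  have ne: "e \<noteq> {} \<and> e \<subseteq> verts H" if "e \<in> edges H" for e
    using assms(1) that unfolding wf_hypergraph_def by blast
  have "edges H = ?A \<union> ?B \<union> ?C" using ne by blast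
  moreover have "card (?A \<union> ?B \<union> ?C) = card ?A + card ?B + card ?C"
    using finite_edges[OF assms(1)] ne by (subst card_Un_disjoint; (subst card_Un_disjoint)?; force)
  ultimately show ?thesis by (simp add: cut_degree_def)
qed

section \<open>Cuts with few edges, and witnesses for missing edges\<close>

text \<open>If all crossing r-sets were edges, d(X) would be at least the cut degree of X in the
  complete hypergraph \<open>?K\<close>, and that is at least C(n-1, r-1), the value for a single
  vertex.\<close>

lemma crossing_non_edge:
  assumes "wf_hypergraph H" "r \<ge> 2" "X \<noteq> {}" "X \<subset> verts H"
    and "cut_degree H X < (card (verts H) - 1) choose (r - 1)"
  shows "\<exists>e. e \<subseteq> verts H \<and> card e = r \<and> e \<notin> edges H \<and>
    e \<inter> X \<noteq> {} \<and> e \<inter> (verts H - X) \<noteq> {}"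
    (is "?P")
proof (rule ccontr)
  assume "\<not> ?P"
  then have all: "e \<in> edges H"
    if "e \<subseteq> verts H" "card e = r" "e \<inter> X \<noteq> {}" "e \<inter> (verts H - X) \<noteq> {}" for e
    using that by blast
  let ?K = "Hypergraph (verts H) {e. e \<subseteq> verts H \<and> card e = r}"
  have fin: "finite (verts H)" using assms(1) by (simp add: wf_hypergraph_def)
  then have finX: "finite X" using assms(4) finite_subset by blast
  have wfK: "wf_hypergraph ?K" using fin assms(2) by (auto simp: wf_hypergraph_def)
  have sub: "{e. e \<subseteq> verts H \<and> card e = r \<and> e \<subseteq> Y} = {e. e \<subseteq> Y \<and> card e = r}"
    if "Y \<subseteq> verts H" for Y using that by blast
  have "cut_degree ?K X \<le> cut_degree H X"
    unfolding cut_degree_def using all finite_edges[OF assms(1)] by (intro card_mono) auto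
  moreover have "card (verts H) choose r = cut_degree ?K X + (card X choose r)
      + ((card (verts H) - card X) choose r)"
    using card_edges_cut[OF wfK, of X] assms(4) fin finX
    by (simp add: sub n_subsets card_Diff_subset psubset_imp_subset)
  \<comment> \<open>The sides have x+1 and y+1 vertices, so n = x+y+2. Superadditivity and Pascal's
    rule leave at least C(x+y+1, r-1) crossing sets.\<close>
  moreover obtain x where x: "card X = Suc x" using finX assms(3) by (cases "card X") auto
  moreover have "card X < card (verts H)" using assms(4) fin by (rule psubset_card_mono[rotated])
  then obtain y where y: "card (verts H) = Suc (Suc (x + y))"
    using x by (metis add_Suc less_imp_Suc_add)
  moreover obtain q where "r = Suc q" using assms(2) by (cases r) auto
  ultimately show False using assms(5) choose_superadditive[OF assms(2), of x y] by simp
qed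

text \<open>A witness avoiding \<open>e\<close> would be a subhypergraph of \<open>H\<close> itself,
  where connectivity is at most \<open>k\<close>.\<close>

lemma edge_maximal_witness:
  assumes "edge_maximal r k l H" "e \<subseteq> verts H" "card e = r" "e \<notin> edges H"
  obtains J where "subhypergraph J (add_edge H e)" "card (verts J) \<ge> l" "edge_connectivity J \<ge> k + 1"
    "e \<in> edges J"
proof -
  obtain J where J: "subhypergraph J (add_edge H e)" "card (verts J) \<ge> l" "edge_connectivity J \<ge> k + 1"
    using assms unfolding edge_maximal_def by blast
  have "e \<in> edges J"
  proof (rule ccontr)
    assume "e \<notin> edges J"
    then have "subhypergraph J H" using J(1) unfolding subhypergraph_def add_edge_def by auto
    then show False using J assms(1) unfolding edge_maximal_def by force
  qed
  then show thesis using J that by blast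
qed

lemma cut_degree_add_edge_le:
  assumes "wf_hypergraph H"
  shows "cut_degree (add_edge H e) X \<le> Suc (cut_degree H X)"
proof -
  let ?C = "{f \<in> edges H. f \<inter> X \<noteq> {} \<and> f \<inter> (verts H - X) \<noteq> {}}"
  have "finite ?C" using finite_edges[OF assms] by simp
  moreover have "cut_degree (add_edge H e) X \<le> card (insert e ?C)"
    unfolding cut_degree_def add_edge_def using \<open>finite ?C\<close> by (intro card_mono) auto
  ultimately show ?thesis unfolding cut_degree_def by (simp add: card_insert_if split: if_splits)
qed

lemma cut_degree_add_edge_inside:
  assumes "e \<subseteq> X"
  shows "cut_degree (add_edge H e) X = cut_degree H X"
  unfolding cut_degree_def add_edge_def using assms by (intro arg_cong[where f = card]) auto

text \<open>If \<open>X\<close> separates vertices of \<open>J\<close>, its trace on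
  \<open>J\<close> is a cut of \<open>J\<close>, and every edge of \<open>J\<close> crossing the
  trace crosses \<open>X\<close> in \<open>H\<close>.\<close>

lemma edge_connectivity_le_outer_cut_degree:
  assumes "finite (verts H)" "finite (edges H)" "subhypergraph J H"
    and "verts J \<inter> X \<noteq> {}" "\<not> verts J \<subseteq> X"
  shows "edge_connectivity J \<le> cut_degree H X"
proof -
  have sub: "verts J \<subseteq> verts H" using assms(3) by (simp add: subhypergraph_def)
  then have fin: "finite (verts J)" using assms(1) finite_subset by blast
  have "edge_connectivity J \<le> cut_degree J (verts J \<inter> X)"
    using assms(4,5) by (intro edge_connectivity_le_cut_degree[OF fin]) auto
  also have "\<dots> \<le> cut_degree H X"
    unfolding cut_degree_def using assms(2,3) sub
    by (intro card_mono) (auto simp: subhypergraph_def)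
  finally show ?thesis .
qed

lemma witness_cut_degree:
  assumes "wf_hypergraph H" "subhypergraph J (add_edge H e)"
    and "verts J \<inter> X \<noteq> {}" "\<not> verts J \<subseteq> X"
  shows "edge_connectivity J \<le> cut_degree (add_edge H e) X"
  using assms finite_edges[OF assms(1)]
  by (intro edge_connectivity_le_outer_cut_degree) (simp_all add: add_edge_def wf_hypergraph_def)

text \<open>Add a missing crossing edge \<open>e\<close>. Its witness \<open>J\<close> contains
  \<open>e\<close> and is therefore split by \<open>X\<close>, so k+1 is at most the cut degree of
  \<open>X\<close> after the addition, hence at most d(X)+1.\<close>

lemma cut_degree_eq:
  assumes "edge_maximal r k l H" "r \<ge> 2" "X \<noteq> {}" "X \<subset> verts H"
    and "cut_degree H X \<le> k" "k < (card (verts H) - 1) choose (r - 1)"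
  shows "cut_degree H X = k"
proof -
  have wf: "wf_hypergraph H" using assms(1) by (simp add: edge_maximal_def)
  obtain e where e: "e \<subseteq> verts H" "card e = r" "e \<notin> edges H" "e \<inter> X \<noteq> {}" "e \<inter> (verts H - X) \<noteq> {}"
    using crossing_non_edge[OF wf assms(2-4) le_less_trans[OF assms(5,6)]] by blast
  obtain J where J: "subhypergraph J (add_edge H e)" "edge_connectivity J \<ge> k + 1" "e \<in> edges J"
    using edge_maximal_witness[OF assms(1) e(1-3)] by blast
  have "e \<subseteq> verts J" using J(1,3) by (simp add: subhypergraph_def)
  then have "edge_connectivity J \<le> cut_degree (add_edge H e) X"
    using e by (intro witness_cut_degree[OF wf J(1)]) auto
  then show ?thesis using J(2) assms(5) cut_degree_add_edge_le[OF wf, of e X] by linarith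
qed

text \<open>An edge added inside \<open>X\<close> leaves d(X) at most \<open>k\<close>. Its witness
  meets \<open>X\<close> and is more than k-connected, so it cannot be split by \<open>X\<close> and
  lies entirely inside.\<close>

lemma induced_maximal_or_small_complete:
  assumes max: "edge_maximal r k l H" and "X \<noteq> {}" "X \<subset> verts H" and cut: "cut_degree H X \<le> k" and "r \<ge> 2"
  shows "maximal_or_small_complete r k l (induced H X)"
proof -
  have wf: "wf_hypergraph H" and unif: "uniform r H" using max by (simp_all add: edge_maximal_def)
  have finX: "finite X" using wf assms(3) finite_subset unfolding wf_hypergraph_def by blast
  have wit: "\<exists>J. subhypergraph J (add_edge (induced H X) e) \<and> card (verts J) \<ge> l \<and> edge_connectivity J \<ge> k + 1"
    if e: "e \<subseteq> X" "card e = r" "e \<notin> edges H" for e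
  proof -
    obtain J where J: "subhypergraph J (add_edge H e)" "card (verts J) \<ge> l" "edge_connectivity J \<ge> k + 1" "e \<in> edges J"
      using edge_maximal_witness[OF max _ e(2,3)] e(1) assms(3) by blast
    have ne: "e \<noteq> {}" using e(2) assms(5) by auto
    have eJ: "e \<subseteq> verts J" using J(1,4) by (simp add: subhypergraph_def)
    have "verts J \<subseteq> X"
    proof (rule ccontr)
      assume "\<not> verts J \<subseteq> X"
      then have "edge_connectivity J \<le> cut_degree (add_edge H e) X"
        using ne eJ e(1) by (intro witness_cut_degree[OF wf J(1)]) auto
      then show False using J(3) cut cut_degree_add_edge_inside[OF e(1), of H] by simp
    qed
    then have "subhypergraph J (add_edge (induced H X) e)"
      using J(1) unfolding subhypergraph_def add_edge_def by force
    then show ?thesis using J by blast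
  qed
  show ?thesis
  proof (cases "card X < l")
    case True
    \<comment> \<open>A witness inside \<open>X\<close> would need at least \<open>l\<close>
      vertices, more than \<open>X\<close> has.\<close>
    have "e \<in> edges H" if e: "e \<subseteq> X" "card e = r" for e
    proof (rule ccontr)
      assume "e \<notin> edges H"
      from wit[OF e this] obtain J where
        J: "subhypergraph J (add_edge (induced H X) e)" "card (verts J) \<ge> l"
        by blast
      then have "card (verts J) \<le> card X"
        using finX by (intro card_mono) (auto simp: subhypergraph_def add_edge_def)
      then show False using J(2) True by simp
    qed
    then have "{e \<in> edges H. e \<subseteq> X} = {e. e \<subseteq> X \<and> card e = r}"
      using unif by (auto simp: uniform_def)
    then show ?thesis using True finX by (simp add: maximal_or_small_complete_def complete_uniform_def)
  next
    case False
    have "subhypergraph J H" if "subhypergraph J (induced H X)" for J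
      using that assms(3) unfolding subhypergraph_def by auto
    then have "edge_maximal r k l (induced H X)"
      using max wit finX unfolding edge_maximal_def
      by (auto simp: wf_hypergraph_def uniform_def)
    then show ?thesis using False by (simp add: maximal_or_small_complete_def)
  qed
qed

text \<open>Double counting: if \<open>X\<close> has \<open>a\<close> vertices, the edges inside contribute at most
  \<open>r * (a choose r) = (a - (r - 1)) * (a choose (r - 1))\<close> to the degree sum over \<open>X\<close>, and each
  crossing edge at most \<open>min a (r - 1)\<close>.  The two bounds together give \<open>a * k\<close>.\<close>

lemma small_cut_has_small_degree_vertex:
  assumes wf: "wf_hypergraph H" and unif: "uniform r H" and "r \<ge> 1"
    and X: "X \<noteq> {}" "X \<subset> verts H" and cut: "cut_degree H X \<le> k"
    and small: "card X choose (r - 1) \<le> k"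
  obtains v where "v \<in> X" "cut_degree H {v} \<le> k"
proof -
  let ?E = "edges H" and ?V = "verts H"
  let ?in = "{e \<in> ?E. e \<subseteq> X}" and ?cr = "{e \<in> ?E. e \<inter> X \<noteq> {} \<and> e \<inter> (?V - X) \<noteq> {}}"
  have finE: "finite ?E" using wf by (rule finite_edges)
  have finX: "finite X" using wf X(2) finite_subset unfolding wf_hypergraph_def by blast
  have edge: "finite e \<and> card e = r \<and> e \<subseteq> ?V \<and> e \<noteq> {}" if "e \<in> ?E" for e
    using that wf unif finite_subset[of e ?V] unfolding wf_hypergraph_def uniform_def by simp
  obtain q where q: "r = Suc q" using assms(3) by (cases r) auto
  have "(\<Sum>v\<in>X. cut_degree H {v}) \<le> (\<Sum>v\<in>X. card {e \<in> ?E. v \<in> e})"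
    unfolding cut_degree_def using finE by (intro sum_mono card_mono) auto
  also have "\<dots> = (\<Sum>v\<in>X. \<Sum>e\<in>?E. if v \<in> e then 1 else 0)"
    using finE by (simp add: sum.If_cases Int_def)
  also have "\<dots> = (\<Sum>e\<in>?E. \<Sum>v\<in>X. if v \<in> e then 1 else 0)" by (rule sum.swap)
  also have "\<dots> = (\<Sum>e\<in>?E. card (X \<inter> e))" using finX by (simp add: sum.If_cases)
  also have "\<dots> = (\<Sum>e\<in>?in \<union> ?cr. card (X \<inter> e))"
    using finE edge by (intro sum.mono_neutral_right) auto
  also have "\<dots> = (\<Sum>e\<in>?in. card (X \<inter> e)) + (\<Sum>e\<in>?cr. card (X \<inter> e))"
    using finE by (intro sum.union_disjoint) auto
  also have "\<dots> \<le> card ?in * r + card ?cr * min (card X) q"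
  proof (rule add_mono; rule sum_bounded_above[where 'a = nat, simplified])
    fix e assume e: "e \<in> ?in"
    then show "card (X \<inter> e) \<le> r" using edge[of e] by (simp add: Int_absorb1)
  next
    fix e assume e: "e \<in> ?cr"
    \<comment> \<open>A crossing edge has a vertex outside \<open>X\<close>, hence at most r-1 =
      \<open>q\<close> vertices inside.\<close>
    then have "card (X \<inter> e) < card e" using edge[of e] by (intro psubset_card_mono) auto
    moreover have "card (X \<inter> e) \<le> card X" using finX by (intro card_mono) auto
    ultimately show "card (X \<inter> e) \<le> min (card X) q" using e edge[of e] q by simp
  qed
  also have "\<dots> \<le> (card X - q) * k + k * min (card X) q"
  proof (rule add_mono)
    have "card ?in \<le> card {e. e \<subseteq> X \<and> card e = r}"
      using edge finX by (intro card_mono) auto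
    then have "card ?in * r \<le> (card X choose r) * r" by (simp add: n_subsets finX)
    also have "\<dots> = (card X - q) * (card X choose q)"
      using times_binomial_minus1_eq[of r "card X"] binomial_absorb_comp[of "card X" q] q
      by (simp add: mult.commute)
    also have "\<dots> \<le> (card X - q) * k" using small q by simp
    finally show "card ?in * r \<le> (card X - q) * k" .
    show "card ?cr * min (card X) q \<le> k * min (card X) q"
      using cut by (simp add: cut_degree_def)
  qed
  \<comment> \<open>With truncated subtraction, (a - q) + min a q = a both for a <= q and for a > q,
    where a = |X|.\<close>
  also have "\<dots> = card X * k"
    by (cases "card X \<le> q") (simp_all add: algebra_simps flip: add_mult_distrib)
  \<comment> \<open>If every vertex of the nonempty set \<open>X\<close> had degree above
    \<open>k\<close>, the sum would be at least |X|(k+1).\<close>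
  also have "\<dots> < (\<Sum>v\<in>X. Suc k)" using X(1) finX by (simp add: card_gt_0_iff)
  finally have "\<exists>v\<in>X. cut_degree H {v} < Suc k"
    by (meson leD not_le_imp_less sum_mono)
  then show thesis using that by force
qed

section \<open>Splitting along exactly \<open>k\<close> edges\<close>

text \<open>Low connectivity supplies a cut with at most \<open>k\<close> edges. If one side has
  fewer than \<open>t\<close> vertices, the cut is replaced by a single vertex of that side.
  Maximality then forces exactly \<open>k\<close> crossing edges and passes the invariant to both
  sides.\<close>

lemma edge_maximal_split:
  fixes H :: "'a hypergraph"
  assumes max: "edge_maximal r k l H" and kr: "k \<ge> 2" "r \<ge> 2" and t: "t = t_param k r"
    and l: "card (verts H) \<ge> l" "l \<ge> t + 1"
  obtains A B :: "'a hypergraph" where "maximal_or_small_complete r k l A" "maximal_or_small_complete r k l B"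
    "card (verts A) + card (verts B) = card (verts H)"
    "card (edges H) = k + card (edges A) + card (edges B)"
    "card (verts A) = 1 \<or> card (verts A) \<ge> t \<and> card (verts B) \<ge> t"
proof -
  have wf: "wf_hypergraph H" and unif: "uniform r H" using max by (simp_all add: edge_maximal_def)
  have fin: "finite (verts H)" using wf by (simp add: wf_hypergraph_def)
  have tr: "t \<ge> r" using t_param_ge kr t by simp
  \<comment> \<open>Here n-1 >= l-1 >= t; this is what ensures a missing r-set across every cut of
    at most \<open>k\<close> edges.\<close>
  have big: "k < (card (verts H) - 1) choose (r - 1)"
  proof -
    have "k < t choose (r - 1)" using t_param(2) kr t by simp
    also have "\<dots> \<le> (card (verts H) - 1) choose (r - 1)" using l by (intro binomial_right_mono) simp
    finally show ?thesis .
  qed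
  have "subhypergraph H H" using wf by (simp add: subhypergraph_def wf_hypergraph_def)
  then have "edge_connectivity H \<le> k" using max l(1) by (simp add: edge_maximal_def)
  moreover have "card (verts H) \<ge> 2" using l tr kr by simp
  ultimately obtain X0 where X0: "X0 \<noteq> {}" "X0 \<subset> verts H" "cut_degree H X0 \<le> k"
    by (metis edge_connectivity_attained)
  have compl: "verts H - X \<noteq> {}" "verts H - X \<subset> verts H" if "X \<noteq> {}" "X \<subset> verts H" for X
    using that by blast+
  \<comment> \<open>The lower inequality defining \<open>t\<close> turns |X| <= t-1 into the
    smallness condition of the double count.\<close>
  have vertex: "\<exists>v\<in>X. cut_degree H {v} \<le> k"
    if X: "X \<noteq> {}" "X \<subset> verts H" "cut_degree H X \<le> k" "card X < t" for X
  proof -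
    have "card X choose (r - 1) \<le> (t - 1) choose (r - 1)" using X(4) by (intro binomial_right_mono) simp
    also have "\<dots> \<le> k" using t_param(1) kr t by simp
    finally have "card X choose (r - 1) \<le> k" .
    moreover have "r \<ge> 1" using kr(2) by simp
    ultimately show ?thesis using small_cut_has_small_degree_vertex[OF wf unif _ X(1-3)] by blast
  qed
  have "\<exists>X. X \<noteq> {} \<and> X \<subset> verts H \<and> cut_degree H X \<le> k \<and>
      (card X = 1 \<or> card X \<ge> t \<and> card (verts H - X) \<ge> t)"
  proof (cases "card X0 \<ge> t \<and> card (verts H - X0) \<ge> t")
    case True
    then show ?thesis using X0 by blast
  next
    case False
    \<comment> \<open>The small side may be the complement, which has the same cut degree.\<close>
    have "cut_degree H (verts H - X0) \<le> k" using X0 cut_degree_compl[of X0 H] by simp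
    then obtain v where v: "v \<in> verts H" "cut_degree H {v} \<le> k"
      using False vertex[of X0] vertex[of "verts H - X0"] X0 compl[OF X0(1,2)] by (metis not_le psubsetD)
    have "card (verts H) \<noteq> 1" using l tr kr by simp
    then have "{v} \<subset> verts H" using v(1) by (metis empty_subsetI insert_subset is_singletonI is_singleton_altdef psubsetI)
    then show ?thesis using v by (intro exI[of _ "{v}"]) auto
  qed
  then obtain X where X: "X \<noteq> {}" "X \<subset> verts H" "cut_degree H X \<le> k"
      "card X = 1 \<or> card X \<ge> t \<and> card (verts H - X) \<ge> t" by blast
  have finX: "finite X" using X(2) fin finite_subset by blast
  show thesis
  proof (rule that[of "induced H X" "induced H (verts H - X)"])
    show "maximal_or_small_complete r k l (induced H X)"
      using induced_maximal_or_small_complete max X kr by blast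
    show "maximal_or_small_complete r k l (induced H (verts H - X))"
      using induced_maximal_or_small_complete[OF max compl[OF X(1,2)]] cut_degree_compl[of X H] X kr by simp
    show "card (verts (induced H X)) + card (verts (induced H (verts H - X))) = card (verts H)"
      using X(2) fin finX by (simp add: card_Diff_subset card_mono psubset_imp_subset)
    show "card (edges H) = k + card (edges (induced H X)) + card (edges (induced H (verts H - X)))"
      using card_edges_cut[OF wf, of X] cut_degree_eq[OF max kr(2) X(1-3) big] X(2) by simp
  qed (use X(4) in simp)
qed

section \<open>Excess of complete hypergraphs and of general hypergraphs\<close>

text \<open>The function f of the overview; it is integer-valued because f(t) may be
  negative.\<close>

definition complete_excess :: "nat \<Rightarrow> nat \<Rightarrow> nat \<Rightarrow> int" where
  "complete_excess r k m = int (m choose r) - (int m - 1) * int k"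

text \<open>Pascal's rule gives the forward difference C(m, r-1) - k. By the choice of
  \<open>t\<close> it is at most 0 for m < t and positive for m >= t, which yields the two
  monotonicity lemmas.\<close>

lemma complete_excess_Suc:
  assumes "r \<ge> 1"
  shows "complete_excess r k (Suc m) = complete_excess r k m + (int (m choose (r - 1)) - int k)"
proof -
  obtain q where "r = Suc q" using assms by (cases r) auto
  then show ?thesis by (simp add: complete_excess_def algebra_simps)
qed

lemma complete_excess_mono:
  assumes "r \<ge> 2" "t_param k r \<le> x" "x \<le> y"
  shows "complete_excess r k x \<le> complete_excess r k y"
  using assms(3,2)
proof (induction rule: dec_induct)
  case (step j)
  have "k < t_param k r choose (r - 1)" using t_param(2) assms(1) by simp
  also have "\<dots> \<le> j choose (r - 1)" using step by (intro binomial_right_mono) simp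
  finally show ?case using step complete_excess_Suc[of r k j] assms(1) by simp
qed simp

lemma complete_excess_antimono:
  assumes "r \<ge> 2" "x \<le> y" "y \<le> t_param k r"
  shows "complete_excess r k y \<le> complete_excess r k x"
  using assms(2,3)
proof (induction rule: dec_induct)
  case (step j)
  have "j choose (r - 1) \<le> (t_param k r - 1) choose (r - 1)" using step by (intro binomial_right_mono) simp
  also have "\<dots> \<le> k" using t_param(1) assms(1) by simp
  finally show ?case using step complete_excess_Suc[of r k j] assms(1) by simp
qed simp

text \<open>f(1) = 0 and f does not increase from 1 to \<open>t\<close>.\<close>

lemma complete_excess_t_nonpos:
  assumes "k \<ge> 1" "r \<ge> 2"
  shows "complete_excess r k (t_param k r) \<le> 0"
  using complete_excess_antimono[of r 1 "t_param k r" k] t_param_ge[OF assms] assms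
  by (simp add: complete_excess_def binomial_eq_0)

text \<open>The linear terms depend only on the sum of the two arguments, so only the binomial
  inequality remains.\<close>

lemma complete_excess_balanced_le:
  assumes "x \<le> c" "2 * c \<le> s"
  shows "complete_excess r k c + complete_excess r k (s - c) \<le> complete_excess r k x + complete_excess r k (s - x)"
proof -
  have "int (c choose r) + int ((s - c) choose r) \<le> int (x choose r) + int ((s - x) choose r)"
    using choose_balanced_le[OF assms, of r] by linarith
  moreover have "(int c - 1) * int k + (int (s - c) - 1) * int k
      = (int x - 1) * int k + (int (s - x) - 1) * int k"
    using assms by (simp flip: distrib_right)
  ultimately show ?thesis unfolding complete_excess_def by linarith
qed

lemma complete_excess_balanced_le_large:
  assumes "r \<ge> 2" "t_param k r \<le> c" "c = l div 2" "t_param k r \<le> x" "t_param k r \<le> y" "l \<le> x + y"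
  shows "complete_excess r k c + complete_excess r k (l - c) \<le> complete_excess r k x + complete_excess r k y"
  using assms(4-6)
proof (induction x y rule: linorder_wlog)
  case (le x y)
  show ?case
  proof (cases "x < c")
    case True
    \<comment> \<open>First balance the pair x, l-x of sum exactly \<open>l\<close>; then enlarge
      l-x to \<open>y\<close>, staying above \<open>t\<close>.\<close>
    then have "complete_excess r k c + complete_excess r k (l - c) \<le> complete_excess r k x + complete_excess r k (l - x)"
      using assms(3) by (intro complete_excess_balanced_le) auto
    moreover have "complete_excess r k (l - x) \<le> complete_excess r k y"
      using assms le True by (intro complete_excess_mono) auto
    ultimately show ?thesis by simp
  next
    case False
    have "complete_excess r k c \<le> complete_excess r k x" using False assms by (intro complete_excess_mono) auto
    \<comment> \<open>For odd \<open>l\<close>, c <= x <= y and x+y >= 2c+1 give y >= c+1 =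
      l-c.\<close>
    moreover have "complete_excess r k (l - c) \<le> complete_excess r k y" using False assms le by (intro complete_excess_mono) auto
    ultimately show ?thesis by simp
  qed
qed (simp add: add.commute)

text \<open>The normalisation makes the excess additive when two hypergraphs are joined by exactly
  \<open>k\<close> edges.\<close>

definition edge_excess :: "nat \<Rightarrow> 'a hypergraph \<Rightarrow> int" where
  "edge_excess k H = int (card (edges H)) - (int (card (verts H)) - 1) * int k"

lemma edge_excess_small:
  assumes "maximal_or_small_complete r k l H" "card (verts H) < l"
  shows "edge_excess k H = complete_excess r k (card (verts H))"
  using assms
  by (simp add: edge_excess_def complete_excess_def maximal_or_small_complete_def complete_uniform_def n_subsets)

lemma edge_excess_singleton:
  "card (verts H) = 1 \<Longrightarrow> edge_excess k H \<ge> 0"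
  by (simp add: edge_excess_def)

section \<open>Lower bounds on the excess by induction along splits\<close>

lemma maximal_split:
  fixes H :: "'a hypergraph"
  assumes "maximal_or_small_complete r k l H" "k \<ge> 2" "r \<ge> 2" "l \<le> card (verts H)" "t_param k r + 1 \<le> l"
  obtains A B :: "'a hypergraph" where "maximal_or_small_complete r k l A" "maximal_or_small_complete r k l B"
    "card (verts A) + card (verts B) = card (verts H)" "edge_excess k H = edge_excess k A + edge_excess k B"
    "card (verts A) = 1 \<or> card (verts A) \<ge> t_param k r \<and> card (verts B) \<ge> t_param k r"
proof -
  have "edge_maximal r k l H" using assms(1,4) by (simp add: maximal_or_small_complete_def)
  then obtain A B :: "'a hypergraph" where AB: "maximal_or_small_complete r k l A" "maximal_or_small_complete r k l B"
    "card (verts A) + card (verts B) = card (verts H)"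
    "card (edges H) = k + card (edges A) + card (edges B)"
    "card (verts A) = 1 \<or> card (verts A) \<ge> t_param k r \<and> card (verts B) \<ge> t_param k r"
    using edge_maximal_split[OF _ assms(2,3) refl assms(4,5)] by blast
  have "edge_excess k H = edge_excess k A + edge_excess k B"
    unfolding edge_excess_def AB(4) AB(3)[symmetric] by (simp add: algebra_simps)
  then show thesis using AB that by blast
qed

text \<open>Two parts of size at least \<open>t\<close> do not fit below 2t vertices, so only single
  vertices are removed, down to a complete hypergraph on l-1 vertices. The range starts at l-1 to
  include this base case.\<close>

lemma edge_excess_ge_below_2t:
  fixes H :: "'a hypergraph"
  assumes "k \<ge> 2" "r \<ge> 2" "t_param k r + 1 \<le> l"
    and "maximal_or_small_complete r k l H" "l - 1 \<le> card (verts H)" "card (verts H) < 2 * t_param k r"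
  shows "edge_excess k H \<ge> complete_excess r k (l - 1)"
  using assms(4-6)
proof (induction "card (verts H)" arbitrary: H rule: less_induct)
  case less
  show ?case
  proof (cases "card (verts H) < l")
    case True
    then have "card (verts H) = l - 1" using less.prems(2) by simp
    then show ?thesis using edge_excess_small[OF less.prems(1) True] by simp
  next
    case False
    then have "l \<le> card (verts H)" by simp
    then obtain A B :: "'a hypergraph" where AB: "maximal_or_small_complete r k l A" "maximal_or_small_complete r k l B"
      "card (verts A) + card (verts B) = card (verts H)" "edge_excess k H = edge_excess k A + edge_excess k B"
      "card (verts A) = 1 \<or> card (verts A) \<ge> t_param k r \<and> card (verts B) \<ge> t_param k r"
      using maximal_split[OF less.prems(1) assms(1,2) _ assms(3)] by blast
    have A1: "card (verts A) = 1" using AB(3,5) less.prems(3) by linarith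
    have "edge_excess k B \<ge> complete_excess r k (l - 1)"
      using AB A1 False less.prems by (intro less.hyps) auto
    then show ?thesis using edge_excess_singleton[OF A1, of k] AB(4) by simp
  qed
qed

lemma div_add_superadditive:
  fixes x y t :: nat
  shows "x div t + y div t \<le> (x + y) div t"
  by (simp add: div_add1_eq[of x y t])

text \<open>Applied with d = f(t) <= 0, whose sign reverses the superadditivity of floors.\<close>

lemma mult_div_superadditive:
  fixes d :: int and x y z t :: nat
  assumes "d \<le> 0" "x + y \<le> z"
  shows "d * int (z div t) \<le> d * int (x div t) + d * int (y div t)"
proof -
  have "x div t + y div t \<le> z div t"
    using div_add_superadditive[of x t y] div_le_mono[OF assms(2), of t] by linarith
  then have "d * int (z div t) \<le> d * int (x div t + y div t)"
    using assms(1) by (intro mult_left_mono_neg) auto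
  then show ?thesis by (simp add: distrib_left)
qed

lemma edge_excess_ge:
  fixes H :: "'a hypergraph"
  assumes "k \<ge> 2" "r \<ge> 2" "t_param k r + 1 \<le> l"
    and "maximal_or_small_complete r k l H" "t_param k r \<le> card (verts H)"
  shows "edge_excess k H \<ge> complete_excess r k (t_param k r) * int (card (verts H) div t_param k r)"
  using assms(4,5)
proof (induction "card (verts H)" arbitrary: H rule: less_induct)
  case less
  let ?t = "t_param k r"
  have t0: "?t > 0" using t_param_ge[of k r] assms by simp
  have d0: "complete_excess r k ?t \<le> 0" using complete_excess_t_nonpos assms by simp
  show ?case
  proof (cases "card (verts H) < l")
    case True
    \<comment> \<open>In the complete case one copy of f(t) suffices: further copies only lower the
      bound, and f is minimal at \<open>t\<close>.\<close>
    have "1 \<le> card (verts H) div ?t" using less.prems(2) t0 by (simp add: Suc_le_eq div_greater_zero_iff)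
    then have "complete_excess r k ?t * int (card (verts H) div ?t) \<le> complete_excess r k ?t * 1"
      using d0 by (intro mult_left_mono_neg) auto
    also have "\<dots> \<le> complete_excess r k (card (verts H))"
      using less.prems assms by (simp add: complete_excess_mono)
    finally show ?thesis using edge_excess_small[OF less.prems(1) True] by simp
  next
    case False
    then have "l \<le> card (verts H)" by simp
    then obtain A B :: "'a hypergraph" where AB: "maximal_or_small_complete r k l A" "maximal_or_small_complete r k l B"
      "card (verts A) + card (verts B) = card (verts H)" "edge_excess k H = edge_excess k A + edge_excess k B"
      "card (verts A) = 1 \<or> card (verts A) \<ge> ?t \<and> card (verts B) \<ge> ?t"
      using maximal_split[OF less.prems(1) assms(1,2) _ assms(3)] by blast
    note sup = mult_div_superadditive[OF d0, of "card (verts A)" "card (verts B)" "card (verts H)" ?t]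
    from AB(5) show ?thesis
    proof
      assume A1: "card (verts A) = 1"
      \<comment> \<open>Removing one vertex leaves at least l-1 >= t vertices, so induction
        applies.\<close>
      have "complete_excess r k ?t * int (card (verts B) div ?t) \<le> edge_excess k B"
        using AB A1 False assms by (intro less.hyps) auto
      moreover have "complete_excess r k ?t * int (card (verts A) div ?t) \<le> 0"
        using d0 by (simp add: mult_nonpos_nonneg)
      ultimately show ?thesis using sup edge_excess_singleton[OF A1, of k] AB(3,4) by linarith
    next
      assume big: "card (verts A) \<ge> ?t \<and> card (verts B) \<ge> ?t"
      have "complete_excess r k ?t * int (card (verts A) div ?t) \<le> edge_excess k A"
        "complete_excess r k ?t * int (card (verts B) div ?t) \<le> edge_excess k B"
        using AB big t0 by (auto intro!: less.hyps)
      then show ?thesis using sup AB(3,4) by linarith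
    qed
  qed
qed

text \<open>While some part keeps at least \<open>l\<close> vertices, that part carries the balanced
  term by induction. Once all parts are below \<open>l\<close>, their excesses are known exactly and
  convexity supplies the term.\<close>

lemma edge_excess_ge_large:
  fixes H :: "'a hypergraph"
  assumes "k \<ge> 2" "r \<ge> 2" "2 * t_param k r + 1 \<le> l" and c: "c = l div 2"
    and "maximal_or_small_complete r k l H" "l \<le> card (verts H)"
  shows "edge_excess k H \<ge> complete_excess r k c + complete_excess r k (l - c)
    + complete_excess r k (t_param k r) * int ((card (verts H) - l) div t_param k r)"
  using assms(5,6)
proof (induction "card (verts H)" arbitrary: H rule: less_induct)
  case less
  let ?t = "t_param k r" and ?bal = "complete_excess r k c + complete_excess r k (l - c)"
  have t0: "?t > 0" using t_param_ge[of k r] assms by simp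
  have tl: "?t + 1 \<le> l" using assms t0 by simp
  have d0: "complete_excess r k ?t \<le> 0" using complete_excess_t_nonpos assms by simp
  have dn: "complete_excess r k ?t * int (m div ?t) \<le> 0" for m
    using d0 by (simp add: mult_nonpos_nonneg)
  \<comment> \<open>\<open>B\<close> inherits the balanced term and \<open>A\<close> gets the
    general bound; the floors combine because n-l = |A| + (|B|-l).\<close>
  have one_big: "?bal + complete_excess r k ?t * int ((card (verts H) - l) div ?t) \<le> edge_excess k A + edge_excess k B"
    if "maximal_or_small_complete r k l A" "maximal_or_small_complete r k l B"
      "card (verts A) + card (verts B) = card (verts H)" "card (verts A) \<ge> ?t" "card (verts B) \<ge> l" for A B :: "'a hypergraph"
  proof -
    have "?bal + complete_excess r k ?t * int ((card (verts B) - l) div ?t) \<le> edge_excess k B"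
      using that t0 by (intro less.hyps) auto
    moreover have "complete_excess r k ?t * int (card (verts A) div ?t) \<le> edge_excess k A"
      using that assms tl by (intro edge_excess_ge) auto
    moreover have "complete_excess r k ?t * int ((card (verts H) - l) div ?t)
      \<le> complete_excess r k ?t * int (card (verts A) div ?t) + complete_excess r k ?t * int ((card (verts B) - l) div ?t)"
      using that by (intro mult_div_superadditive[OF d0]) auto
    ultimately show ?thesis by linarith
  qed
  obtain A B :: "'a hypergraph" where AB: "maximal_or_small_complete r k l A" "maximal_or_small_complete r k l B"
    "card (verts A) + card (verts B) = card (verts H)" "edge_excess k H = edge_excess k A + edge_excess k B"
    "card (verts A) = 1 \<or> card (verts A) \<ge> ?t \<and> card (verts B) \<ge> ?t"
    using maximal_split[OF less.prems(1) assms(1,2) less.prems(2) tl] by blast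
  from AB(5) show ?case
  proof
    assume A1: "card (verts A) = 1"
    note A0 = edge_excess_singleton[OF A1, of k]
    show ?thesis
    proof (cases "l \<le> card (verts B)")
      case True
      have "?bal + complete_excess r k ?t * int ((card (verts B) - l) div ?t) \<le> edge_excess k B"
        using AB(2,3) A1 True by (intro less.hyps) auto
      moreover have "complete_excess r k ?t * int ((card (verts H) - l) div ?t)
        \<le> complete_excess r k ?t * int (0 div ?t) + complete_excess r k ?t * int ((card (verts B) - l) div ?t)"
        using AB(3) by (intro mult_div_superadditive[OF d0]) auto
      ultimately show ?thesis using A0 AB(4) by simp
    next
      case False
      \<comment> \<open>The sizes 1 and l-1 form the most uneven split of \<open>l\<close>, and f(1)
        = 0.\<close>
      have B: "card (verts B) = l - 1" using False AB(3) A1 less.prems by simp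
      have "?bal \<le> complete_excess r k 1 + complete_excess r k (l - 1)"
        using assms t0 by (intro complete_excess_balanced_le) auto
      moreover have "complete_excess r k 1 = 0" using assms by (simp add: complete_excess_def binomial_eq_0)
      moreover have "edge_excess k B = complete_excess r k (l - 1)"
        using edge_excess_small[OF AB(2)] B False by simp
      ultimately show ?thesis using A0 AB(4) dn[of "card (verts H) - l"] by linarith
    qed
  next
    assume big: "card (verts A) \<ge> ?t \<and> card (verts B) \<ge> ?t"
    consider "l \<le> card (verts B)" | "l \<le> card (verts A)" | "card (verts A) < l" "card (verts B) < l"
      by linarith
    then show ?thesis
    proof cases
      case 1
      then show ?thesis using one_big[OF AB(1,2,3)] big AB(4) by simp
    next
      case 2
      then show ?thesis using one_big[OF AB(2,1)] AB(3,4) big by (simp add: add.commute)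
    next
      case 3
      \<comment> \<open>Both parts are complete, have at least \<open>t\<close> vertices and total
        at least \<open>l\<close>.\<close>
      have "?bal \<le> complete_excess r k (card (verts A)) + complete_excess r k (card (verts B))"
        using big assms AB(3) less.prems by (intro complete_excess_balanced_le_large) auto
      then show ?thesis
        using edge_excess_small[OF AB(1) 3(1)] edge_excess_small[OF AB(2) 3(2)] AB(4)
          dn[of "card (verts H) - l"] by linarith
    qed
  qed
qed

section \<open>From excess bounds to edge counts\<close>

theorem theorem4p3:
  fixes H :: "'a hypergraph" and n k l r t :: nat
  assumes "k \<ge> 2" and "r \<ge> 2"
    and "t = t_param k r"
    and "n \<ge> l" and "l \<ge> t + 1"
    and "wf_hypergraph H" and "uniform r H" and "card (verts H) = n"
    and "edge_maximal r k l H"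
  shows "(l \<le> n \<and> n < 2 * t \<longrightarrow>
           int (card (edges H)) \<ge> int ((l - 1) choose r) + (int n - int l + 1) * int k) \<and>
     (l \<le> 2 * t \<and> 2 * t \<le> n \<longrightarrow>
           int (card (edges H)) \<ge> (int n - 1) * int k
             - ((int t - 1) * int k - int (t choose r)) * (int n div int t)) \<and>
     (\<forall>a::nat. n \<ge> l \<and> l = 2 * a \<and> 2 * a \<ge> 2 * t + 1 \<longrightarrow>
           int (card (edges H)) \<ge> (int n - 2 * int a + 1) * int k + 2 * int (a choose r)
             - ((int t - 1) * int k - int (t choose r)) * ((int n - 2 * int a) div int t)) \<and>
     (\<forall>b::nat. n \<ge> l \<and> l = 2 * b + 1 \<and> 2 * b + 1 \<ge> 2 * t + 1 \<longrightarrow>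
           int (card (edges H)) \<ge> (int n - 2 * int b) * int k + int (b choose r) + int ((b + 1) choose r)
             - ((int t - 1) * int k - int (t choose r)) * ((int n - 2 * int b - 1) div int t))"
proof -
  have good: "maximal_or_small_complete r k l H"
    using assms by (simp add: maximal_or_small_complete_def)
  have size: "int (card (edges H)) = edge_excess k H + (int n - 1) * int k"
    using assms by (simp add: edge_excess_def)
  \<comment> \<open>The coefficient subtracted in the last three bounds is -f(t), matching the floor
    terms of the excess bounds.\<close>
  have D: "(int t - 1) * int k - int (t choose r) = - complete_excess r k t" by (simp add: complete_excess_def)
  note tl = assms(5)[unfolded assms(3)]
  have "int (card (edges H)) \<ge> int ((l - 1) choose r) + (int n - int l + 1) * int k" if "n < 2 * t"
    using edge_excess_ge_below_2t[OF assms(1,2) tl good] that assms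
    by (simp add: size complete_excess_def algebra_simps)
  moreover have "int (card (edges H)) \<ge> (int n - 1) * int k
      - ((int t - 1) * int k - int (t choose r)) * (int n div int t)"
    using edge_excess_ge[OF assms(1,2) tl good] assms(3,4,5,8)
    unfolding size D by (simp add: zdiv_int)
  moreover have large: "int (card (edges H)) \<ge> (int n - 1) * int k + complete_excess r k c + complete_excess r k (l - c)
      - ((int t - 1) * int k - int (t choose r)) * ((int n - int l) div int t)"
    if "2 * t + 1 \<le> l" "c = l div 2" for c
    using edge_excess_ge_large[OF assms(1,2) _ that(2) good] that assms(3,4,8)
    unfolding size D by (simp add: zdiv_int)
  have "int (card (edges H)) \<ge> (int n - 2 * int a + 1) * int k + 2 * int (a choose r)
      - ((int t - 1) * int k - int (t choose r)) * ((int n - 2 * int a) div int t)"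
    if "l = 2 * a" "2 * a \<ge> 2 * t + 1" for a
  proof -
    \<comment> \<open>Even \<open>l\<close>: both halves equal \<open>a\<close>, and the linear
      terms sum to (n-1) - 2(a-1) = n-2a+1 times \<open>k\<close>.\<close>
    have "2 * t + 1 \<le> l" "a = l div 2" "l - a = a" "int l = 2 * int a" using that by auto
    from large[OF this(1,2)] this(3,4) show ?thesis
      by (simp only: complete_excess_def[of r k a]) (simp add: left_diff_distrib distrib_right mult.assoc)
  qed
  moreover have "int (card (edges H)) \<ge> (int n - 2 * int b) * int k + int (b choose r) + int ((b + 1) choose r)
      - ((int t - 1) * int k - int (t choose r)) * ((int n - 2 * int b - 1) div int t)"
    if "l = 2 * b + 1" "2 * b + 1 \<ge> 2 * t + 1" for b
  proof -
    \<comment> \<open>Odd \<open>l\<close>: the halves are \<open>b\<close> and b+1, and the linear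
      terms sum to (n-1) - (b-1) - b = n-2b times \<open>k\<close>.\<close>
    have "2 * t + 1 \<le> l" "b = l div 2" "l - b = b + 1" "int n - int l = int n - 2 * int b - 1" using that by auto
    from large[OF this(1,2)] this(3,4) show ?thesis
      by (simp only: complete_excess_def[of r k b] complete_excess_def[of r k "b + 1"])
        (simp add: left_diff_distrib distrib_right mult.assoc)
  qed
  ultimately show ?thesis using assms(4) by blast
qed

end
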